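(* Let $\Lambda$ be a set of positive integers with $1\in\Lambda$, let $p,q$ be nonnegative integers, let $G$ be a finite simple graph, let $(S,\varphi)$ be an external $\Lambda$-selector of width $p$ in $G$, and put $U=V(G)\setminus S$. For every vertex $s\in S$ that is nonisolated in $G$, choose an anchor $a_s\in N_G(s)$. Let $H$ be the simple graph obtained from $G$ by contracting every edge $sa_s$ ($s\in S$ nonisolated) and deleting the isolated vertices of $G$ that belong to $S$. If $H$ is $q$-colorable, then $G$ has a proper coloring with at most $p+q$ colors such that every nonisolated vertex $v$ of $G$ has a color whose multiplicity in its open neighborhood (the number of vertices of $N_G(v)$ with that color) belongs to $\Lambda$.
   Context: All graphs are finite and simple; after contractions, loops and parallel edges are discarded. $N_G(v)$ and $N_G[v]$ denote the open and closed neighborhoods of $v$, and $[p]=\{1,\ldots,p\}$. For a set $\Lambda$ of positive integers with $1\in\Lambda$, an external $\Lambda$-selector of width $p$ in $G$ is a pair $(S,\varphi)$ consisting of an independent set $S\subseteq V(G)$ and a map $\varphi:S\to[p]$ such that for every $x\in V(G)\setminus S$ there is a color $i\in[p]$ with $|N_G[x]\cap\varphi^{-1}(i)|\in\Lambda$. A graph is $q$-colorable if it has a proper vertex coloring with at most $q$ colors. *)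

theory Defs
  imports "Graph_Theory.Pair_Digraph" "HOL-Library.FuncSet"
begin

(* A finite simple graph is a pair_graph: a finite, loop-free, symmetric digraph without
   parallel arcs; an edge uv is the pair of arcs (u,v), (v,u). *)

definition open_nbhd :: "'a pair_pre_digraph \<Rightarrow> 'a \<Rightarrow> 'a set" where
  "open_nbhd G v = {w. (v, w) \<in> parcs G}"

definition closed_nbhd :: "'a pair_pre_digraph \<Rightarrow> 'a \<Rightarrow> 'a set" where
  "closed_nbhd G v = insert v (open_nbhd G v)"

definition isolated :: "'a pair_pre_digraph \<Rightarrow> 'a \<Rightarrow> bool" where
  "isolated G v \<longleftrightarrow> v \<in> pverts G \<and> open_nbhd G v = {}"

definition independent_set :: "'a pair_pre_digraph \<Rightarrow> 'a set \<Rightarrow> bool" where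
  "independent_set G S \<longleftrightarrow> S \<subseteq> pverts G \<and> (\<forall>u\<in>S. \<forall>v\<in>S. (u, v) \<notin> parcs G)"

(* phi is only meaningful on S, so the colour class of i is the set of s in S with phi s = i. *)
definition external_selector ::
  "nat set \<Rightarrow> nat \<Rightarrow> 'a pair_pre_digraph \<Rightarrow> 'a set \<Rightarrow> ('a \<Rightarrow> nat) \<Rightarrow> bool" where
  "external_selector \<Lambda> p G S \<phi> \<longleftrightarrow>
     independent_set G S \<and> \<phi> \<in> S \<rightarrow> {1..p} \<and>
     (\<forall>x \<in> pverts G - S. \<exists>i \<in> {1..p}. card (closed_nbhd G x \<inter> {s \<in> S. \<phi> s = i}) \<in> \<Lambda>)"

definition proper_coloring :: "'a pair_pre_digraph \<Rightarrow> ('a \<Rightarrow> nat) \<Rightarrow> bool" where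
  "proper_coloring G c \<longleftrightarrow> (\<forall>(u, v) \<in> parcs G. c u \<noteq> c v)"

definition colorable :: "nat \<Rightarrow> 'a pair_pre_digraph \<Rightarrow> bool" where
  "colorable q G \<longleftrightarrow> (\<exists>c. proper_coloring G c \<and> card (c ` pverts G) \<le> q)"

(* Contracting the edges in F: the new vertices are the vertex sets of the connected components
   of the graph with edge set F. F may contain either or both orientations of an edge. *)
definition contract_class :: "'a rel \<Rightarrow> 'a \<Rightarrow> 'a set" where
  "contract_class F v = (F \<union> F\<inverse>)\<^sup>* `` {v}"

definition contract_edges :: "'a pair_pre_digraph \<Rightarrow> 'a rel \<Rightarrow> 'a set pair_pre_digraph" where
  "contract_edges G F =
     \<lparr> pverts = contract_class F ` pverts G,
       parcs = {(contract_class F u, contract_class F v) | u v.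
                  (u, v) \<in> parcs G \<and> contract_class F u \<noteq> contract_class F v} \<rparr>"

definition delete_verts :: "'a pair_pre_digraph \<Rightarrow> 'a set \<Rightarrow> 'a pair_pre_digraph" where
  "delete_verts G X =
     \<lparr> pverts = pverts G - X, parcs = {(u, v) \<in> parcs G. u \<notin> X \<and> v \<notin> X} \<rparr>"

(* An isolated vertex s of G meets no contracted edge, so in the contracted graph it is {s}. *)
definition anchor_contraction ::
  "'a pair_pre_digraph \<Rightarrow> 'a set \<Rightarrow> ('a \<Rightarrow> 'a) \<Rightarrow> 'a set pair_pre_digraph" where
  "anchor_contraction G S a =
     delete_verts (contract_edges G {(s, a s) | s. s \<in> S \<and> \<not> isolated G s})
       {{s} | s. s \<in> S \<and> isolated G s}"

end

theory Submission
  imports Defs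
begin

text \<open>Since \<open>S\<close> is independent, every anchor lies in \<open>U\<close>, so the contracted edges form stars
  whose centers are in \<open>U\<close>, and distinct vertices of \<open>U\<close> stay distinct in \<open>H\<close>. Color \<open>S\<close> by
  \<open>\<phi>\<close> and \<open>U\<close> by a coloring of \<open>H\<close> with a disjoint palette. A vertex of \<open>U\<close> is then served by
  the selector. A nonisolated \<open>s \<in> S\<close> is contracted into \<open>a\<^sub>s\<close>, so every other neighbor of \<open>s\<close> is
  adjacent to \<open>a\<^sub>s\<close> in \<open>H\<close>, and the color of \<open>a\<^sub>s\<close> occurs exactly once around \<open>s\<close>.\<close>

lemma contract_class_self: "v \<in> contract_class F v"
  by (simp add: contract_class_def)

lemma contract_class_edge:
  assumes "(u, v) \<in> F"
  shows "contract_class F u = contract_class F v"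
proof -
  have "sym ((F \<union> F\<inverse>)\<^sup>*)"
    by (intro sym_rtrancl) (auto simp: sym_def)
  moreover have "(u, v) \<in> (F \<union> F\<inverse>)\<^sup>*"
    using assms by auto
  ultimately show ?thesis
    unfolding contract_class_def by (auto dest: symD intro: rtrancl_trans)
qed

text \<open>A function constant along every edge of \<open>F\<close> is constant along paths, by
  induction on the path. So two classes are told apart by exhibiting such a function with different
  values at their representatives.\<close>

lemma contract_class_eq_imp_invariant_eq:
  assumes inv: "\<And>x y. (x, y) \<in> F \<Longrightarrow> r x = r y"
    and eq: "contract_class F u = contract_class F v"
  shows "r u = r v"
proof -
  have "(v, u) \<in> (F \<union> F\<inverse>)\<^sup>*"
    using contract_class_self[of u F] unfolding eq by (simp add: contract_class_def)
  then show ?thesis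
    by (induction rule: rtrancl_induct) (use inv in fastforce)+
qed

theorem lemma3p1:
  fixes \<Lambda> :: "nat set" and p q :: nat
    and G :: "'a pair_pre_digraph"
    and S :: "'a set" and \<phi> :: "'a \<Rightarrow> nat" and a :: "'a \<Rightarrow> 'a"
  assumes "0 \<notin> \<Lambda>" and "1 \<in> \<Lambda>"
    and "pair_graph G"
    and "external_selector \<Lambda> p G S \<phi>"
    and "\<And>s. s \<in> S \<Longrightarrow> \<not> isolated G s \<Longrightarrow> a s \<in> open_nbhd G s"
    and "colorable q (anchor_contraction G S a)"
  shows "\<exists>c :: 'a \<Rightarrow> nat.
           proper_coloring G c \<and> card (c ` pverts G) \<le> p + q \<and>
           (\<forall>v \<in> pverts G. \<not> isolated G v \<longrightarrow>
              (\<exists>i. card {u \<in> open_nbhd G v. c u = i} \<in> \<Lambda>))"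
proof -
  interpret pair_graph G by fact
  have indep: "\<And>u v. u \<in> S \<Longrightarrow> v \<in> S \<Longrightarrow> (u, v) \<notin> parcs G"
    and phi: "\<And>s. s \<in> S \<Longrightarrow> \<phi> s \<in> {1..p}"
    and sel: "\<And>x. x \<in> pverts G - S \<Longrightarrow>
      \<exists>i \<in> {1..p}. card (closed_nbhd G x \<inter> {s \<in> S. \<phi> s = i}) \<in> \<Lambda>"
    using assms(4) by (auto simp: external_selector_def independent_set_def)
  have anchor: "(s, a s) \<in> parcs G" "a s \<notin> S" if "s \<in> S" "\<not> isolated G s" for s
    using assms(5)[OF that] indep that(1) by (auto simp: open_nbhd_def)
  define F where "F = {(s, a s) | s. s \<in> S \<and> \<not> isolated G s}"
  let ?K = "contract_class F"
  let ?H = "anchor_contraction G S a"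
  obtain d where d: "proper_coloring ?H d" "card (d ` pverts ?H) \<le> q"
    using assms(6) by (auto simp: colorable_def)

  \<comment> \<open>The invariant is the retraction onto star centers: it is constant on each edge
    \<open>(s, a s)\<close> because \<open>a s\<close> is outside \<open>S\<close> and hence fixed,
    and it is the identity off \<open>S\<close>.\<close>
  have K_inj: "?K u \<noteq> ?K v" if "u \<notin> S" "v \<notin> S" "u \<noteq> v" for u v
    using contract_class_eq_imp_invariant_eq
      [of F "\<lambda>v. if v \<in> S \<and> \<not> isolated G v then a v else v" u v] anchor that
    by (auto simp: F_def)
  have K_kept: "?K u \<notin> {{s} | s. s \<in> S \<and> isolated G s}" if "u \<notin> S" for u
    using contract_class_self[of u F] that by auto
  \<comment> \<open>The extra vertex \<open>w\<close> lets one fact serve two cases: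
    \<open>w = u\<close> for edges outside \<open>S\<close>, and \<open>w\<close> in
    \<open>S\<close> with anchor \<open>u\<close> for edges that \<open>u\<close> inherits by
    contraction.\<close>
  have H_arc: "(?K u, ?K v) \<in> parcs ?H"
    if "(w, v) \<in> parcs G" "?K w = ?K u" "u \<notin> S" "v \<notin> S" "u \<noteq> v" for u v w
    using that K_inj[of u v] K_kept[of u] K_kept[of v]
    unfolding anchor_contraction_def delete_verts_def contract_edges_def F_def[symmetric]
    by (simp del: mem_Collect_eq) (simp, metis)
  have d_neq: "d (?K u) \<noteq> d (?K v)"
    if "(w, v) \<in> parcs G" "?K w = ?K u" "u \<notin> S" "v \<notin> S" "u \<noteq> v" for u v w
    using H_arc[OF that] d(1) by (auto simp: proper_coloring_def)

  \<comment> \<open>\<open>d\<close> may take the value 0, so the shift by \<open>Suc p\<close> is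
    what keeps the second palette above \<open>p\<close>.\<close>
  define c where "c = (\<lambda>v. if v \<in> S then \<phi> v else Suc (p + d (?K v)))"
  have cS: "c v = \<phi> v" "c v \<le> p" if "v \<in> S" for v
    using that phi by (auto simp: c_def)
  have cU: "c v = Suc (p + d (?K v))" if "v \<notin> S" for v
    using that by (simp add: c_def)

  have "c u \<noteq> c v" if uv: "(u, v) \<in> parcs G" for u v
  proof -
    have "u \<noteq> v"
      using uv no_loops by fastforce
    then show ?thesis
      using d_neq[of u v u] indep[of u v] uv cS(2)[of u] cS(2)[of v] cU[of u] cU[of v]
      by (cases "u \<in> S"; cases "v \<in> S") auto
  qed
  then have "proper_coloring G c"
    by (auto simp: proper_coloring_def)
  moreover have "card (c ` pverts G) \<le> p + q"
  proof -
    have fin: "finite (d ` pverts ?H)"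
      by (simp add: anchor_contraction_def delete_verts_def contract_edges_def)
    \<comment> \<open>\<open>colorable\<close> bounds the number of colors, not their values, so the
      second palette is a shifted image of \<open>d\<close> rather than an interval.\<close>
    have "c ` pverts G \<subseteq> {1..p} \<union> (\<lambda>j. Suc (p + j)) ` d ` pverts ?H"
    proof (rule image_subsetI)
      fix v assume v: "v \<in> pverts G"
      show "c v \<in> {1..p} \<union> (\<lambda>j. Suc (p + j)) ` d ` pverts ?H"
      proof (cases "v \<in> S")
        case True
        then show ?thesis using phi cS by auto
      next
        case False
        have "?K v \<in> pverts ?H"
          using v K_kept[OF False]
          unfolding anchor_contraction_def delete_verts_def contract_edges_def F_def[symmetric]
          by simp
        then show ?thesis using cU[OF False] by blast
      qed
    qed
    then have "card (c ` pverts G) \<le> card ({1..p} \<union> (\<lambda>j. Suc (p + j)) ` d ` pverts ?H)"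
      by (intro card_mono) (use fin in auto)
    also have "\<dots> \<le> card {1..p} + card ((\<lambda>j. Suc (p + j)) ` d ` pverts ?H)"
      by (rule card_Un_le)
    also have "\<dots> \<le> p + q"
      using card_image_le[OF fin, of "\<lambda>j. Suc (p + j)"] d(2) by simp
    finally show ?thesis .
  qed
  moreover have "\<exists>i. card {u \<in> open_nbhd G v. c u = i} \<in> \<Lambda>"
    if v: "v \<in> pverts G" "\<not> isolated G v" for v
  proof (cases "v \<in> S")
    case True
    note anchor_v = anchor[OF True v(2)]
    have "?K v = ?K (a v)"
      by (rule contract_class_edge) (use True v(2) in \<open>auto simp: F_def\<close>)
    then have "c u \<noteq> c (a v)" if "(v, u) \<in> parcs G" "u \<noteq> a v" for u
      using that d_neq[of v u "a v"] indep[OF True, of u] anchor_v cU[of u] cU[of "a v"]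
      by (cases "u \<in> S") auto
    then have "{u \<in> open_nbhd G v. c u = c (a v)} = {a v}"
      using anchor_v by (auto simp: open_nbhd_def)
    then show ?thesis
      using assms(2) by (intro exI[of _ "c (a v)"]) simp
  next
    case False
    then obtain i where i: "i \<in> {1..p}" "card (closed_nbhd G v \<inter> {s \<in> S. \<phi> s = i}) \<in> \<Lambda>"
      using sel v(1) by blast
    \<comment> \<open>Colors up to \<open>p\<close> occur only on \<open>S\<close>. As
      \<open>v\<close> is outside \<open>S\<close>, passing from the closed to the open neighborhood
      loses no vertex of color \<open>i\<close>.\<close>
    have "c u = i \<longleftrightarrow> u \<in> S \<and> \<phi> u = i" for u
      using i(1) cS[of u] cU[of u] by (cases "u \<in> S") auto
    then have "{u \<in> open_nbhd G v. c u = i} = closed_nbhd G v \<inter> {s \<in> S. \<phi> s = i}"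
      using False by (auto simp: closed_nbhd_def)
    then show ?thesis
      using i(2) by (intro exI[of _ i]) simp
  qed
  ultimately show ?thesis by blast
qed

end
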